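(* Let $T>0$, $q\ge 1$, let $U$ be a bounded subset of $V$, and let $\mathcal U_{ad}=\{f\in L^q(0,T;V): f(s)\in U \text{ for a.e. } s\in[0,T]\}$ (with the analogous definition for other final times). Assume: (a) for each $N\ge1$ the linear flow $e^{L_N t}:\mathcal H_N\to\mathcal H_N$ extends to a $C_0$-semigroup $T_N(t)$ on $\mathcal H$ with $\|T_N(t)\|\le M e^{\omega t}$ for all $N\ge 1$, $t\ge0$; $\lim_{N\to\infty}\|L_N\phi-L\phi\|_{\mathcal H}=0$ for all $\phi\in D(L)$; and $F:\mathcal H\to\mathcal H$ is locally Lipschitz; (b) $L$ is self-adjoint and $\mathcal H_N=\mathrm{span}\{e_k:k=1,\dots,N\}$, $N\ge1$, where the $e_k$ are the eigenfunctions of $L$; (c) for each $T>0$ and $(x,u)\in\mathcal H\times\mathcal U_{ad}$, the state equation admits a unique mild solution $y(\cdot;x,u)\in C([0,T],\mathcal H)$ and, for each $N\ge1$, its Galerkin approximation admits a unique solution $y_N(\cdot;\Pi_N x,u)\in C([0,T],\mathcal H)$; moreover there is a constant $\mathcal C=\mathcal C(T,x)$ such that $\|y(t;x,u)\|_{\mathcal H}\le\mathcal C$ and $\|y_N(t;\Pi_Nx,u)\|_{\mathcal H}\le\mathcal C$ for all $t\in[0,T]$, $N\ge1$, $u\in\mathcal U_{ad}$; (d) $\mathcal G:\mathcal H\to[0,\infty)$ is locally Lipschitz and $\mathcal E:V\to[0,\infty)$ is continuous; (e) for each $(t,x)\in[0,T)\times\mathcal H$ there exists a minimizer $u^*_{t,x}$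 of $J_{t,x}$ over $\mathcal U_{ad}[t,T]$ and, for each $N\ge1$, a minimizer $u^{N,*}_{t,x_N}$ of $J^N_{t,x_N}$ over $\mathcal U_{ad}[t,T]$, where $x_N=\Pi_Nx$. Then for any $(t,x)\in[0,T)\times\mathcal H$ there exists a constant $\gamma>0$, independent of $N$ and of the control, such that for all $N\ge1$ and all $u\in\mathcal U_{ad}[t,T]$ $$|J_{t,x}(u)-J^N_{t,x_N}(u)|\le\mathrm{Lip}(\mathcal G|_{\mathfrak B})\big[\sqrt{T-t}+\gamma(T-t)\big]\,\|\Pi_N^\perp y_{t,x}(\cdot;u)\|_{L^2(t,T;\mathcal H)},$$ and, with this same constant $\gamma$, for all $N\ge1$ $$|v(t,x)-v_N(t,x_N)|\le\mathrm{Lip}(\mathcal G|_{\mathfrak B})\big[\sqrt{T-t}+\gamma(T-t)\big]\Big(\|\Pi_N^\perp y_{t,x}(\cdot;u^*_{t,x})\|_{L^2(t,T;\mathcal H)}+\|\Pi_N^\perp y_{t,x}(\cdot;u^{N,*}_{t,x_N})\|_{L^2(t,T;\mathcal H)}\Big).$$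
   Context: $\mathcal H$ and $V$ are separable Hilbert spaces; $F:\mathcal H\to\mathcal H$ and $\mathfrak C:V\to\mathcal H$ are (possibly nonlinear) maps, with $\mathfrak C(0)=0$. The operator $L:D(L)\subset\mathcal H\to\mathcal H$ is the infinitesimal generator of a $C_0$-semigroup $(T(t))_{t\ge0}$ of bounded linear operators on $\mathcal H$, and $M\ge1$, $\omega\ge0$ are constants with $\|T(t)\|\le Me^{\omega t}$ for $t\ge0$ ($\|\cdot\|$ is the operator norm). (The letter $T$ alone denotes the final time.) State equation: $\frac{dy}{dt}=Ly+F(y)+\mathfrak C(u(t))$ on $(0,T]$, $y(0)=x\in\mathcal H$. A mild solution over $[0,T]$ is $y\in C([0,T],\mathcal H)$ with $y(t)=T(t)x+\int_0^tT(t-s)F(y(s))\,ds+\int_0^tT(t-s)\mathfrak C(u(s))\,ds$ for $t\in[0,T]$; it is denoted $y(\cdot;x,u)$. Galerkin approximation: $(\mathcal H_N)_{N\ge1}$ is a sequence of finite-dimensional subspaces of $\mathcal H$ with $\mathcal H_N\subset D(L)$, $\Pi_N:\mathcal H\to\mathcal H_N$ is the orthogonal projector, and $\|(\Pi_N-\mathrm{Id})x\|_{\mathcal H}\to0$ as $N\to\infty$ for all $x\in\mathcal H$. Put $L_N:=\Pi_NL\Pi_N:\mathcal H\to\mathcal H_N$ and $\Pi_N^\perp:=\mathrm{Id}_{\mathcal H}-\Pi_N$. The Galerkin approximation is $\frac{dy_N}{dt}=L_Ny_N+\Pi_NF(y_N)+\Pi_N\mathfrak C(u(t))$ on $[0,T]$,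 $y_N(0)=\Pi_Nx$, understood through the variation-of-constants formula $y_N(t)=e^{L_Nt}\Pi_Nx+\int_0^te^{L_N(t-s)}\Pi_NF(y_N(s))\,ds+\int_0^te^{L_N(t-s)}\Pi_N\mathfrak C(u(s))\,ds$; its solution is denoted $y_N(\cdot;\Pi_Nx,u)$. Problems started at time $t$: for $t\in[0,T)$ put $\mathcal U_{ad}[t,T]:=\{u|_{[t,T]}:u\in\mathcal U_{ad}\}$. For $u\in\mathcal U_{ad}[t,T]$, $y_{t,x}(\cdot;u)$ denotes the mild solution over $[t,T]$ of $\frac{dy}{ds}=Ly+F(y)+\mathfrak C(u(s))$, $s\in(t,T]$, $y(t)=x$, and $y^N_{t,x_N}(\cdot;u)$ denotes the solution of $\frac{dy_N}{ds}=L_Ny_N+\Pi_NF(y_N)+\Pi_N\mathfrak C(u(s))$, $s\in(t,T]$, $y_N(t)=x_N:=\Pi_Nx$. Cost functionals and value functions: for $t\in[0,T)$ and $u\in\mathcal U_{ad}[t,T]$, $$J_{t,x}(u):=\int_t^T[\mathcal G(y_{t,x}(s;u))+\mathcal E(u(s))]\,ds,\qquad J^N_{t,x_N}(u):=\int_t^T[\mathcal G(y^N_{t,x_N}(s;u))+\mathcal E(u(s))]\,ds,$$ $$v(t,x):=\inf_{u\in\mathcal U_{ad}[t,T]}J_{t,x}(u),\qquad v_N(t,x_N):=\inf_{u\in\mathcal U_{ad}[t,T]}J^N_{t,x_N}(u).$$ A map $f:\mathcal W_1\to\mathcal W_2$ between Banach spaces is locally Lipschitz if for every ball $\mathfrak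 B_r\subset\mathcal W_1$ of radius $r$ centered at the origin there is a constant $\mathrm{Lip}(f|_{\mathfrak B_r})>0$ with $\|f(y_1)-f(y_2)\|\le\mathrm{Lip}(f|_{\mathfrak B_r})\|y_1-y_2\|$ on $\mathfrak B_r$. $\mathfrak B$ denotes the (closed) ball of $\mathcal H$ centered at the origin with radius $\mathcal C=\mathcal C(T,x)$, the constant in hypothesis (c). *)

theory Defs
  imports "HOL-Analysis.Analysis"
begin

(* Separable (real) Hilbert spaces are types of sort
   {real_inner, banach, second_countable_topology}.
   An unbounded operator is a total function L together with its domain D;
   the values of L outside D carry no meaning. *)

definition C0_semigroup :: "(real \<Rightarrow> 'h::real_normed_vector \<Rightarrow>\<^sub>L 'h) \<Rightarrow> bool" where
  "C0_semigroup S \<longleftrightarrow>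
     S 0 = id_blinfun \<and>
     (\<forall>s\<ge>0. \<forall>t\<ge>0. S (s + t) = S s o\<^sub>L S t) \<and>
     (\<forall>x. ((\<lambda>t. blinfun_apply (S t) x) \<longlongrightarrow> x) (at_right 0))"

definition infinitesimal_generator ::
  "(real \<Rightarrow> 'h::real_normed_vector \<Rightarrow>\<^sub>L 'h) \<Rightarrow> 'h set \<Rightarrow> ('h \<Rightarrow> 'h) \<Rightarrow> bool" where
  "infinitesimal_generator S D L \<longleftrightarrow>
     D = {x. \<exists>z. ((\<lambda>h. (blinfun_apply (S h) x - x) /\<^sub>R h) \<longlongrightarrow> z) (at_right 0)} \<and>
     (\<forall>x\<in>D. ((\<lambda>h. (blinfun_apply (S h) x - x) /\<^sub>R h) \<longlongrightarrow> L x) (at_right 0))"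

(* Graph of the adjoint; it is single-valued when D is dense. *)
definition adjoint_graph :: "'h::real_inner set \<Rightarrow> ('h \<Rightarrow> 'h) \<Rightarrow> ('h \<times> 'h) set" where
  "adjoint_graph D L = {(y, z). \<forall>x\<in>D. L x \<bullet> y = x \<bullet> z}"

definition self_adjoint_operator :: "'h::real_inner set \<Rightarrow> ('h \<Rightarrow> 'h) \<Rightarrow> bool" where
  "self_adjoint_operator D L \<longleftrightarrow>
     closure D = UNIV \<and> adjoint_graph D L = {(y, L y) | y. y \<in> D}"

definition eigenvector_of :: "'h::real_vector set \<Rightarrow> ('h \<Rightarrow> 'h) \<Rightarrow> 'h \<Rightarrow> bool" where
  "eigenvector_of D L v \<longleftrightarrow> v \<in> D \<and> v \<noteq> 0 \<and> (\<exists>c::real. L v = c *\<^sub>R v)"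

definition orthogonal_projector_onto :: "'h::real_inner set \<Rightarrow> ('h \<Rightarrow> 'h) \<Rightarrow> bool" where
  "orthogonal_projector_onto W P \<longleftrightarrow> (\<forall>x. P x \<in> W \<and> (\<forall>w\<in>W. (x - P x) \<bullet> w = 0))"

definition galerkin_operator :: "('h \<Rightarrow> 'h) \<Rightarrow> ('h \<Rightarrow> 'h) \<Rightarrow> 'h \<Rightarrow> 'h" where
  "galerkin_operator P L = P \<circ> L \<circ> P"

definition operator_exp :: "('h::real_normed_vector \<Rightarrow> 'h) \<Rightarrow> real \<Rightarrow> 'h \<Rightarrow> 'h" where
  "operator_exp A t x = (\<Sum>n. (t ^ n / fact n) *\<^sub>R (A ^^ n) x)"

(* Balls centred at the origin, not neighbourhoods of points. *)
definition lipschitz_on_balls :: "('a::real_normed_vector \<Rightarrow> 'b::real_normed_vector) \<Rightarrow> bool" where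
  "lipschitz_on_balls f \<longleftrightarrow> (\<forall>r>0. \<exists>l>0. l-lipschitz_on (cball 0 r) f)"

(* L^q(0,T;V)-controls with values in U, given by representatives; as V is
   separable, measurable and strongly measurable functions coincide. *)
definition admissible_controls ::
  "real \<Rightarrow> 'v::{real_inner, banach, second_countable_topology} set \<Rightarrow> real \<Rightarrow> (real \<Rightarrow> 'v) set" where
  "admissible_controls q U T =
     {f. f \<in> borel_measurable (lebesgue_on {0..T}) \<and>
         integrable (lebesgue_on {0..T}) (\<lambda>s. norm (f s) powr q) \<and>
         (AE s in lebesgue_on {0..T}. f s \<in> U)}"

definition admissible_controls_from ::
  "real \<Rightarrow> 'v::{real_inner, banach, second_countable_topology} set \<Rightarrow> real \<Rightarrow> real \<Rightarrow> (real \<Rightarrow> 'v) set" where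
  "admissible_controls_from q U t T = (\<lambda>u. restrict u {t..T}) ` admissible_controls q U T"

(* Variation of constants on [a,b] for dy/ds = A y + F(y) + B(u(s)), y(a) = x, where S is the
   flow of A. The existence of the integrals is part of the notion, since the
   Bochner integral of a non-integrable function is 0 by convention. *)
definition voc_solution ::
  "(real \<Rightarrow> 'h \<Rightarrow> 'h) \<Rightarrow> ('h \<Rightarrow> 'h) \<Rightarrow> ('v \<Rightarrow> 'h) \<Rightarrow> real \<Rightarrow> real \<Rightarrow> 'h \<Rightarrow> (real \<Rightarrow> 'v) \<Rightarrow>
   (real \<Rightarrow> 'h::{real_inner, banach, second_countable_topology}) \<Rightarrow> bool" where
  "voc_solution S F B a b x u y \<longleftrightarrow>
     continuous_on {a..b} y \<and>
     (\<forall>t\<in>{a..b}.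
        set_integrable lebesgue {a..t} (\<lambda>s. S (t - s) (F (y s))) \<and>
        set_integrable lebesgue {a..t} (\<lambda>s. S (t - s) (B (u s))) \<and>
        y t = S (t - a) x
            + (LINT s:{a..t}|lebesgue. S (t - s) (F (y s)))
            + (LINT s:{a..t}|lebesgue. S (t - s) (B (u s))))"

definition mild_solution ::
  "(real \<Rightarrow> 'h \<Rightarrow>\<^sub>L 'h) \<Rightarrow> ('h \<Rightarrow> 'h) \<Rightarrow> ('v \<Rightarrow> 'h) \<Rightarrow> real \<Rightarrow> real \<Rightarrow> 'h \<Rightarrow> (real \<Rightarrow> 'v) \<Rightarrow>
   (real \<Rightarrow> 'h::{real_inner, banach, second_countable_topology}) \<Rightarrow> bool" where
  "mild_solution S F B = voc_solution (\<lambda>t. blinfun_apply (S t)) F B"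

(* P is the projector and L the unprojected operator. *)
definition galerkin_solution ::
  "('h \<Rightarrow> 'h) \<Rightarrow> ('h \<Rightarrow> 'h) \<Rightarrow> ('h \<Rightarrow> 'h) \<Rightarrow> ('v \<Rightarrow> 'h) \<Rightarrow> real \<Rightarrow> real \<Rightarrow> 'h \<Rightarrow> (real \<Rightarrow> 'v) \<Rightarrow>
   (real \<Rightarrow> 'h::{real_inner, banach, second_countable_topology}) \<Rightarrow> bool" where
  "galerkin_solution P L F B =
     voc_solution (operator_exp (galerkin_operator P L)) (P \<circ> F) (P \<circ> B)"

(* Uniqueness only concerns the values on [a,b]. *)
definition uniquely_solvable_on :: "real \<Rightarrow> real \<Rightarrow> ((real \<Rightarrow> 'h) \<Rightarrow> bool) \<Rightarrow> bool" where
  "uniquely_solvable_on a b sol \<longleftrightarrow>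
     (\<exists>y. sol y \<and> (\<forall>z. sol z \<longrightarrow> (\<forall>s\<in>{a..b}. z s = y s)))"

(* Under unique solvability the two functions below are determined on [a,b]. *)
definition the_mild_solution ::
  "(real \<Rightarrow> 'h \<Rightarrow>\<^sub>L 'h) \<Rightarrow> ('h \<Rightarrow> 'h) \<Rightarrow> ('v \<Rightarrow> 'h) \<Rightarrow> real \<Rightarrow> real \<Rightarrow> 'h \<Rightarrow> (real \<Rightarrow> 'v) \<Rightarrow>
   real \<Rightarrow> 'h::{real_inner, banach, second_countable_topology}" where
  "the_mild_solution S F B a b x u = (SOME y. mild_solution S F B a b x u y)"

definition the_galerkin_solution ::
  "('h \<Rightarrow> 'h) \<Rightarrow> ('h \<Rightarrow> 'h) \<Rightarrow> ('h \<Rightarrow> 'h) \<Rightarrow> ('v \<Rightarrow> 'h) \<Rightarrow> real \<Rightarrow> real \<Rightarrow> 'h \<Rightarrow> (real \<Rightarrow> 'v) \<Rightarrow>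
   real \<Rightarrow> 'h::{real_inner, banach, second_countable_topology}" where
  "the_galerkin_solution P L F B a b x u = (SOME y. galerkin_solution P L F B a b x u y)"

(* The integrand is nonnegative, and the integral may be infinite: a continuous
   function E need not be bounded on a bounded set of controls. *)
definition running_cost ::
  "('h \<Rightarrow> real) \<Rightarrow> ('v \<Rightarrow> real) \<Rightarrow> real \<Rightarrow> real \<Rightarrow> (real \<Rightarrow> 'h) \<Rightarrow> (real \<Rightarrow> 'v) \<Rightarrow> ennreal" where
  "running_cost G E t T y u = (\<integral>\<^sup>+ s\<in>{t..T}. ennreal (G (y s) + E (u s)) \<partial>lebesgue)"

definition minimizer_over :: "'a set \<Rightarrow> ('a \<Rightarrow> ennreal) \<Rightarrow> 'a \<Rightarrow> bool" where
  "minimizer_over A J u \<longleftrightarrow> u \<in> A \<and> (\<forall>w\<in>A. J u \<le> J w)"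

(* |a - b| on [0,\<infinity>], with \<infinity> - \<infinity> read as 0 (in ennreal it is \<infinity>). *)
definition ennreal_absdiff :: "ennreal \<Rightarrow> ennreal \<Rightarrow> ennreal" where
  "ennreal_absdiff a b = (if a = b then 0 else max a b - min a b)"

definition L2_norm_on :: "real \<Rightarrow> real \<Rightarrow> (real \<Rightarrow> 'h::real_normed_vector) \<Rightarrow> real" where
  "L2_norm_on t T f = sqrt (LINT s:{t..T}|lebesgue. (norm (f s))\<^sup>2)"

end

theory Submission
  imports Defs
begin

text \<open>
  Since \<open>L\<close> is self-adjoint and \<open>H N\<close> is spanned by eigenvectors of \<open>L\<close>, the projector \<open>P N\<close> commutes
  with the semigroup \<open>S\<close>, and the Galerkin flow is the restriction of \<open>S\<close> to \<open>H N\<close>. Hence, for a mild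
  solution \<open>y\<close> and the Galerkin solution \<open>z\<close>, the control terms cancel in
  \<open>z t - P y t = \<integral> P S (t - s) (F (z s) - F (y s)) ds\<close>, and Gronwall bounds \<open>z - P y\<close> by the \<open>L\<^sup>1\<close> norm of
  \<open>y - P y\<close>, hence by its \<open>L\<^sup>2\<close> norm. The Lipschitz bound on \<open>G\<close> carries this over to the costs, and testing
  each infimum with the minimizer of the other problem to the value functions.
\<close>

section \<open>Strongly continuous semigroups, their generators, and eigenvectors of the
  generator\<close>

locale semigroup_generator =
  fixes S :: "real \<Rightarrow> 'h::{real_inner, banach, second_countable_topology} \<Rightarrow>\<^sub>L 'h"
    and D :: "'h set" and L :: "'h \<Rightarrow> 'h" and M \<omega> :: real
  assumes C0: "C0_semigroup S"
    and generator: "infinitesimal_generator S D L"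
    and growth: "\<And>t. t \<ge> 0 \<Longrightarrow> norm (S t) \<le> M * exp (\<omega> * t)"
    and M_ge: "M \<ge> 1" and \<omega>_nonneg: "\<omega> \<ge> 0"
begin

lemma S_zero [simp]: "S 0 x = x"
  using C0 by (simp add: C0_semigroup_def)

lemma S_add: "s \<ge> 0 \<Longrightarrow> t \<ge> 0 \<Longrightarrow> S (s + t) x = S s (S t x)"
  using C0 by (simp add: C0_semigroup_def)

lemma S_strongly_continuous: "((\<lambda>t. S t x) \<longlongrightarrow> x) (at_right 0)"
  using C0 by (simp add: C0_semigroup_def)

lemma norm_S_le:
  assumes "0 \<le> s" "s \<le> t" shows "norm (S s x) \<le> M * exp (\<omega> * t) * norm x"
proof -
  have "norm (S s) \<le> M * exp (\<omega> * s)" using growth assms by simp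
  also have "\<dots> \<le> M * exp (\<omega> * t)"
    using M_ge \<omega>_nonneg assms by (simp add: mult_left_mono)
  finally show ?thesis
    using norm_blinfun[of "S s" x] by (meson mult_right_mono norm_ge_zero order_trans)
qed

lemma quotient_tendsto: "x \<in> D \<Longrightarrow> ((\<lambda>h. (S h x - x) /\<^sub>R h) \<longlongrightarrow> L x) (at_right 0)"
  using generator by (simp add: infinitesimal_generator_def)

lemma L_eqI: "x \<in> D \<Longrightarrow> ((\<lambda>h. (S h x - x) /\<^sub>R h) \<longlongrightarrow> z) (at_right 0) \<Longrightarrow> L x = z"
  using tendsto_unique[OF _ quotient_tendsto] by (metis trivial_limit_at_right_real)

lemma D_I: "((\<lambda>h. (S h x - x) /\<^sub>R h) \<longlongrightarrow> z) (at_right 0) \<Longrightarrow> x \<in> D"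
  using generator by (auto simp: infinitesimal_generator_def)

lemma L_add: assumes "x \<in> D" "y \<in> D" shows "L (x + y) = L x + L y"
proof -
  have "((\<lambda>h. (S h (x + y) - (x + y)) /\<^sub>R h) \<longlongrightarrow> L x + L y) (at_right 0)"
    using tendsto_add[OF assms[THEN quotient_tendsto]]
    by (simp add: blinfun.add_right algebra_simps)
  then show ?thesis using D_I L_eqI by blast
qed

lemma L_scaleR: assumes "x \<in> D" shows "L (c *\<^sub>R x) = c *\<^sub>R L x"
proof -
  have "((\<lambda>h. (S h (c *\<^sub>R x) - c *\<^sub>R x) /\<^sub>R h) \<longlongrightarrow> c *\<^sub>R L x) (at_right 0)"
    using tendsto_scaleR[OF tendsto_const[of c] quotient_tendsto[OF assms]]
    by (simp add: blinfun.scaleR_right algebra_simps)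
  then show ?thesis using D_I L_eqI by blast
qed

text \<open>By the semigroup law, applying the bounded operator \<open>S t\<close> to the difference
  quotient of \<open>x\<close> at time 0 gives the difference quotient of \<open>S t x\<close>, so
  the limit passes through \<open>S t\<close>.\<close>

lemma S_invariant:
  assumes "x \<in> D" "t \<ge> 0" shows "S t x \<in> D" "L (S t x) = S t (L x)"
proof -
  have "((\<lambda>h. S t ((S h x - x) /\<^sub>R h)) \<longlongrightarrow> S t (L x)) (at_right 0)"
    by (intro tendsto_intros quotient_tendsto assms)
  moreover have "\<forall>\<^sub>F h in at_right 0. S t ((S h x - x) /\<^sub>R h) = (S h (S t x) - S t x) /\<^sub>R h"
    using eventually_at_right_less[of 0]
    by eventually_elim
      (metis S_add add.commute assms(2) blinfun.diff_right blinfun.scaleR_right order_less_imp_le)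
  ultimately have "((\<lambda>h. (S h (S t x) - S t x) /\<^sub>R h) \<longlongrightarrow> S t (L x)) (at_right 0)"
    by (rule Lim_transform_eventually)
  then show "S t x \<in> D" "L (S t x) = S t (L x)" using D_I L_eqI by blast+
qed

text \<open>The generator only provides a right derivative at time 0. With
  \<open>m = min s t\<close> and \<open>h = \<bar>s - t\<bar>\<close>, the quotient between
  \<open>s\<close> and \<open>t\<close> on either side is \<open>S m\<close> applied to the quotient
  of \<open>x\<close> at \<open>h\<close>. Since \<open>m \<le> t\<close>, the operators
  \<open>S m\<close> are uniformly bounded, and strong continuity replaces \<open>S m (L x)\<close>
  by \<open>S t (L x)\<close> in the limit.\<close>

lemma S_has_vector_derivative:
  assumes "x \<in> D" "t \<ge> 0"
  shows "((\<lambda>s. S s x) has_vector_derivative S t (L x)) (at t within {0..})"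
proof -
  let ?F = "at t within {0..}" and ?c = "M * exp (\<omega> * t)"
  let ?q = "\<lambda>h. (S h x - x) /\<^sub>R h" and ?m = "\<lambda>s. min s t"
  have pos: "\<forall>\<^sub>F s in ?F. s \<ge> 0 \<and> s \<noteq> t" by (auto simp: eventually_at_filter)
  have right: "filterlim (\<lambda>s. \<bar>s - t\<bar>) (at_right 0) ?F"
    unfolding filterlim_at
    by (auto intro!: tendsto_eq_intros eventually_mono[OF pos])
  \<comment> \<open>\<open>t - min s t\<close> is 0 for \<open>s \<ge> t\<close>, so it does not
    tend to 0 through positive values. The absolute value turns one-sided continuity into two-sided
    continuity at 0, and composition is then allowed to hit 0.\<close>
  have left0: "((\<lambda>r. S \<bar>r\<bar> (L x)) \<longlongrightarrow> L x) (at 0)"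
  proof (rule filterlim_compose[OF S_strongly_continuous])
    show "filterlim (\<lambda>r::real. \<bar>r\<bar>) (at_right 0) (at 0)"
      by (auto simp: filterlim_at eventually_at_filter intro!: tendsto_eq_intros)
  qed
  have left: "((\<lambda>s. S \<bar>t - ?m s\<bar> (L x)) \<longlongrightarrow> L x) ?F"
  proof -
    have "((\<lambda>s. t - ?m s) \<longlongrightarrow> 0) ?F" by (auto intro!: tendsto_eq_intros)
    with left0 show ?thesis
      using tendsto_compose[of "\<lambda>r. S \<bar>r\<bar> (L x)" 0 "\<lambda>s. t - ?m s" ?F] by simp
  qed
  have "((\<lambda>s. ?c * norm (?q \<bar>s - t\<bar> - L x) + ?c * norm (L x - S \<bar>t - ?m s\<bar> (L x))) \<longlongrightarrow> 0) ?F"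
    using tendsto_add[OF
        tendsto_mult_right_zero[OF tendsto_norm_zero[OF LIM_zero[OF
              filterlim_compose[OF quotient_tendsto[OF assms(1)] right]]]]
        tendsto_mult_right_zero[OF tendsto_norm_zero[OF LIM_zero[OF left]]], of ?c ?c]
    by (simp add: norm_minus_commute)
  moreover have "\<forall>\<^sub>F s in ?F. norm ((S s x - S t x) /\<^sub>R (s - t) - S t (L x))
      \<le> ?c * norm (?q \<bar>s - t\<bar> - L x) + ?c * norm (L x - S \<bar>t - ?m s\<bar> (L x))"
    using pos
  proof eventually_elim
    case (elim s)
    define h m where "h = \<bar>s - t\<bar>" and "m = ?m s"
    have m: "0 \<le> m" "m \<le> t" "0 \<le> t - m" and h: "h > 0" using elim assms by (auto simp: m_def h_def)
    have mh: "S (m + h) x = S m (S h x)" using S_add[of m h] m h by simp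
    have tm: "S t (L x) = S m (S (t - m) (L x))" using S_add[of m "t - m"] m by simp
    have "(S s x - S t x) /\<^sub>R (s - t) = (S (m + h) x - S m x) /\<^sub>R h"
    proof (cases "s < t")
      case True
      then have "m + h = t" "m = s" "h = - (s - t)" by (auto simp: m_def h_def)
      then show ?thesis by (metis inverse_minus_eq minus_diff_eq scaleR_minus_left scaleR_minus_right)
    next
      case False
      then have "m + h = s" "m = t" "h = s - t" by (auto simp: m_def h_def)
      then show ?thesis by simp
    qed
    \<comment> \<open>The first term is the error of the quotient at time 0; the second is the
      defect of continuity, which vanishes when \<open>s \<ge> t\<close>.\<close>
    also have "\<dots> - S t (L x) = S m (?q h - L x) + S m (L x - S (t - m) (L x))"
      unfolding mh tm by (simp add: blinfun.diff_right blinfun.scaleR_right)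
    also have "norm \<dots> \<le> ?c * norm (?q h - L x) + ?c * norm (L x - S (t - m) (L x))"
      by (intro norm_triangle_mono norm_S_le m)
    finally show ?case using m by (simp add: h_def m_def)
  qed
  ultimately have "((\<lambda>s. norm ((S s x - S t x) /\<^sub>R (s - t) - S t (L x))) \<longlongrightarrow> 0) ?F"
    by (rule tendsto_norm_zero[OF Lim_null_comparison, rotated])
  moreover have "\<forall>\<^sub>F s in ?F. norm ((S s x - S t x) /\<^sub>R (s - t) - S t (L x))
      = norm (S s x - S t x - (s - t) *\<^sub>R S t (L x)) / norm (s - t)"
    using pos
  proof eventually_elim
    case (elim s)
    then have "s - t \<noteq> 0" by simp
    then have "(S s x - S t x) /\<^sub>R (s - t) - S t (L x)
        = (S s x - S t x - (s - t) *\<^sub>R S t (L x)) /\<^sub>R (s - t)"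
      by (simp add: scaleR_diff_right[of "inverse _"])
    then show ?case by (simp only: norm_scaleR norm_inverse real_norm_def abs_inverse divide_inverse_commute)
  qed
  ultimately have "((\<lambda>s. norm (S s x - S t x - (s - t) *\<^sub>R S t (L x)) / norm (s - t)) \<longlongrightarrow> 0) ?F"
    by (rule Lim_transform_eventually)
  then show ?thesis
    by (simp add: has_vector_derivative_def has_derivative_iff_norm bounded_linear_scaleR_left)
qed

text \<open>The function \<open>exp (- c * s) *\<^sub>R S s w\<close> has zero derivative on
  \<open>{0..}\<close>, hence keeps its value \<open>w\<close> at 0.\<close>

lemma S_eigenvector:
  assumes "w \<in> D" "L w = c *\<^sub>R w" "t \<ge> 0"
  shows "S t w = exp (c * t) *\<^sub>R w"
proof -
  have "((\<lambda>s. exp (- c * s) *\<^sub>R S s w) has_vector_derivative 0) (at s within {0..})"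
    if "s \<in> {0..}" for s
    using that
    by (auto intro!: derivative_eq_intros S_has_vector_derivative assms(1) 
        simp: assms(2) blinfun.scaleR_right)
  from has_vector_derivative_zero_constant[OF convex_real_interval(1) this]
  obtain k where k: "\<And>s. s \<in> {0..} \<Longrightarrow> exp (- c * s) *\<^sub>R S s w = k" by blast
  have "exp (- c * t) *\<^sub>R S t w = w" using k[of 0] k[of t] assms(3) by simp
  then have "exp (c * t) *\<^sub>R w = (exp (c * t) * exp (- c * t)) *\<^sub>R S t w" by (metis scaleR_scaleR)
  then show ?thesis by (simp flip: exp_add)
qed

text \<open>The weak counterpart for arbitrary \<open>x\<close>, from which \<open>S t\<close> is
  seen to preserve orthogonality to \<open>w\<close>. For \<open>x\<close> in \<open>D\<close>,
  symmetry of \<open>L\<close> moves the eigenvalue onto the scalar function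
  \<open>S s x \<bullet> w\<close>, which therefore solves a linear scalar equation. Both sides are
  continuous in \<open>x\<close> and \<open>D\<close> is dense.\<close>

lemma S_inner_eigenvector:
  assumes "self_adjoint_operator D L" "w \<in> D" "L w = c *\<^sub>R w" "t \<ge> 0"
  shows "S t x \<bullet> w = exp (c * t) * (x \<bullet> w)"
proof -
  have sym: "L y \<bullet> w = c * (y \<bullet> w)" if "y \<in> D" for y
  proof -
    have "(w, L w) \<in> adjoint_graph D L" using assms(1,2) by (auto simp: self_adjoint_operator_def)
    then show ?thesis using that by (auto simp: adjoint_graph_def assms(3))
  qed
  have on_D: "S t y \<bullet> w = exp (c * t) * (y \<bullet> w)" if "y \<in> D" for y
  proof -
    have "((\<lambda>s. exp (- c * s) * (S s y \<bullet> w)) has_real_derivative 0) (at s within {0..})"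
      if "s \<in> {0..}" for s
    proof -
      have "((\<lambda>s. S s y \<bullet> w) has_vector_derivative S s (L y) \<bullet> w) (at s within {0..})"
        using that \<open>y \<in> D\<close>
        by (auto intro!: bounded_linear.has_vector_derivative[OF bounded_linear_inner_left]
            S_has_vector_derivative)
      then have "((\<lambda>s. S s y \<bullet> w) has_real_derivative c * (S s y \<bullet> w)) (at s within {0..})"
        using that S_invariant[OF \<open>y \<in> D\<close>, of s] sym[of "S s y"]
        by (simp add: has_real_derivative_iff_has_vector_derivative)
      then show ?thesis by (auto intro!: derivative_eq_intros)
    qed
    from has_field_derivative_zero_constant[OF convex_real_interval(1) this]
    obtain k where k: "\<And>s. s \<in> {0..} \<Longrightarrow> exp (- c * s) * (S s y \<bullet> w) = k" by blast
    have "exp (- c * t) * (S t y \<bullet> w) = y \<bullet> w" using k[of 0] k[of t] assms(4) by simp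
    then have "exp (c * t) * (y \<bullet> w) = (exp (c * t) * exp (- c * t)) * (S t y \<bullet> w)" by simp
    then show ?thesis by (simp flip: exp_add)
  qed
  have "x \<in> closure D" using assms(1) by (simp add: self_adjoint_operator_def)
  moreover have "closed {y. S t y \<bullet> w = exp (c * t) * (y \<bullet> w)}"
    by (intro closed_Collect_eq continuous_intros)
  then have "closure D \<subseteq> {y. S t y \<bullet> w = exp (c * t) * (y \<bullet> w)}"
    using on_D by (intro closure_minimal) auto
  ultimately show ?thesis by blast
qed

end

section \<open>Orthogonal projectors onto subspaces\<close>

text \<open>Uniqueness of the orthogonal projection: \<open>P x - p\<close> lies in \<open>W\<close>
  and is orthogonal to \<open>W\<close>, hence to itself.\<close>

lemma orthogonal_projector_eqI:
  assumes "subspace W" "orthogonal_projector_onto W P" "p \<in> W" "\<And>w. w \<in> W \<Longrightarrow> (x - p) \<bullet> w = 0"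
  shows "P x = p"
proof -
  have "P x - p \<in> W" using assms by (auto simp: orthogonal_projector_onto_def intro: subspace_diff)
  then have "(x - p) \<bullet> (P x - p) = 0" "(x - P x) \<bullet> (P x - p) = 0"
    using assms by (auto simp: orthogonal_projector_onto_def)
  then have "(P x - p) \<bullet> (P x - p) = 0" by (simp add: inner_diff_left)
  then show ?thesis by simp
qed

lemma orthogonal_projector_fixes:
  "subspace W \<Longrightarrow> orthogonal_projector_onto W P \<Longrightarrow> w \<in> W \<Longrightarrow> P w = w"
  by (rule orthogonal_projector_eqI) auto

lemma norm_orthogonal_projector_le:
  assumes "orthogonal_projector_onto W P" shows "norm (P x) \<le> norm x"
proof -
  have "(x - P x) \<bullet> P x = 0" using assms by (auto simp: orthogonal_projector_onto_def)
  then have "norm (P x) * norm (P x) = x \<bullet> P x"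
    by (simp add: inner_diff_left flip: power2_eq_square power2_norm_eq_inner)
  also have "\<dots> \<le> norm x * norm (P x)" by (rule norm_cauchy_schwarz)
  finally show ?thesis by (cases "P x = 0") auto
qed

text \<open>A projector is only known as a function satisfying the orthogonality relations. These
  are linear in the argument, so linearity follows from uniqueness of the projection.\<close>

lemma bounded_linear_orthogonal_projector:
  assumes W: "subspace W" and P: "orthogonal_projector_onto W P"
  shows "bounded_linear P"
proof (rule bounded_linear_intro[where K=1])
  have *: "P x \<in> W" "\<And>w. w \<in> W \<Longrightarrow> (x - P x) \<bullet> w = 0" for x
    using P by (auto simp: orthogonal_projector_onto_def)
  show "P (x + y) = P x + P y" for x y
    using *(2)[of _ x] *(2)[of _ y]
    by (intro orthogonal_projector_eqI[OF W P] subspace_add W * )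
      (auto simp: inner_diff_left inner_add_left)
  show "P (r *\<^sub>R x) = r *\<^sub>R P x" for r x
    using *(2)[of _ x]
    by (intro orthogonal_projector_eqI[OF W P] subspace_scale W * )
      (auto simp: inner_diff_left)
qed (use norm_orthogonal_projector_le[OF P] in auto)

section \<open>Galerkin spaces spanned by eigenvectors: the Galerkin flow and commutation of
  projector and semigroup\<close>

locale spectral_galerkin = semigroup_generator S D L M \<omega>
  for S :: "real \<Rightarrow> 'h::{real_inner, banach, second_countable_topology} \<Rightarrow>\<^sub>L 'h"
    and D L M \<omega> +
  fixes B W :: "'h set" and P :: "'h \<Rightarrow> 'h"
  assumes self_adjoint: "self_adjoint_operator D L"
    and eigen: "\<And>w. w \<in> B \<Longrightarrow> eigenvector_of D L w"
    and W_eq: "W = span B" and W_subset: "W \<subseteq> D"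
    and projector: "orthogonal_projector_onto W P"
begin

lemma subspace_W: "subspace W" by (simp add: W_eq)

lemma P_in: "P x \<in> W" using projector by (auto simp: orthogonal_projector_onto_def)

lemma bounded_linear_P: "bounded_linear P"
  using bounded_linear_orthogonal_projector[OF subspace_W projector] .

interpretation P: bounded_linear P by (rule bounded_linear_P)

lemma linear_galerkin_operator: "linear (galerkin_operator P L)"
  using P_in W_subset
  by (intro linearI) (auto simp: galerkin_operator_def P.add P.scaleR L_add L_scaleR subset_iff)

lemma linear_galerkin_power: "linear (galerkin_operator P L ^^ n)"
proof (induction n)
  case (Suc n)
  then show ?case using linear_compose[OF _ linear_galerkin_operator] by (simp add: o_def)
qed (simp add: linear_iff)

text \<open>The vectors with this property form a subspace. It contains each eigenvector in
  \<open>B\<close>, where the Galerkin operator is multiplication by the eigenvalue and the series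
  is the scalar exponential series. Proving convergence matters because \<open>operator_exp\<close>
  is an infinite sum that says nothing about a divergent series.\<close>

lemma galerkin_exp_sums:
  assumes "w \<in> W" "t \<ge> 0"
  shows "(\<lambda>n. (t ^ n / fact n) *\<^sub>R (galerkin_operator P L ^^ n) w) sums S t w"
proof -
  let ?A = "galerkin_operator P L"
  let ?X = "{w. (\<lambda>n. (t ^ n / fact n) *\<^sub>R (?A ^^ n) w) sums S t w}"
  have "subspace ?X"
    unfolding subspace_def
  proof (intro conjI ballI allI)
    show "0 \<in> ?X" by (simp add: linear_0 linear_galerkin_power)
    show "x + y \<in> ?X" if "x \<in> ?X" "y \<in> ?X" for x y
      using sums_add[of _ "S t x" _ "S t y"] that
      by (simp add: linear_add linear_galerkin_power blinfun.add_right scaleR_add_right)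
    show "c *\<^sub>R x \<in> ?X" if "x \<in> ?X" for c x
    proof -
      have "(\<lambda>n. (t ^ n / fact n) *\<^sub>R (?A ^^ n) (c *\<^sub>R x))
          = (\<lambda>n. c *\<^sub>R ((t ^ n / fact n) *\<^sub>R (?A ^^ n) x))"
        by (simp add: linear_scale linear_galerkin_power mult.commute)
      with sums_scaleR_right[of "\<lambda>n. (t ^ n / fact n) *\<^sub>R (?A ^^ n) x" "S t x" c] that
      show ?thesis by (simp only: mem_Collect_eq blinfun.scaleR_right)
    qed
  qed
  moreover have "B \<subseteq> ?X"
  proof
    fix w assume w: "w \<in> B"
    then obtain c where c: "w \<in> D" "L w = c *\<^sub>R w" using eigen by (auto simp: eigenvector_of_def)
    have "P w = w" using w orthogonal_projector_fixes[OF subspace_W projector] by (auto simp: W_eq span_base)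
    then have "?A w = c *\<^sub>R w" by (simp add: galerkin_operator_def c P.scaleR)
    then have pow: "(?A ^^ n) w = c ^ n *\<^sub>R w" for n
      by (induction n) (simp_all add: linear_scale[OF linear_galerkin_operator] mult.commute)
    have "(\<lambda>n. ((c * t) ^ n /\<^sub>R fact n) *\<^sub>R w) sums (exp (c * t) *\<^sub>R w)"
      by (intro sums_scaleR_left exp_converges)
    then show "w \<in> ?X"
      by (simp add: pow S_eigenvector[OF c assms(2)] power_mult_distrib field_simps)
  qed
  ultimately have "span B \<subseteq> ?X" by (intro span_minimal)
  then show ?thesis using assms W_eq by auto
qed

lemma galerkin_exp_eq: "w \<in> W \<Longrightarrow> t \<ge> 0 \<Longrightarrow> operator_exp (galerkin_operator P L) t w = S t w"
  unfolding operator_exp_def by (rule sums_unique[symmetric, OF galerkin_exp_sums])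

lemma S_maps_W: assumes "w \<in> W" "t \<ge> 0" shows "S t w \<in> W"
proof -
  have "subspace {w. S t w \<in> W}"
    using subspace_W by (auto simp: subspace_def blinfun.add_right blinfun.scaleR_right)
  moreover have "B \<subseteq> {w. S t w \<in> W}"
    using eigen S_eigenvector[OF _ _ assms(2)]
    by (auto simp: eigenvector_of_def W_eq) (metis span_base span_scale)
  ultimately show ?thesis using assms(1) span_minimal W_eq by blast
qed

text \<open>\<open>S t\<close> maps \<open>W\<close> into itself and, by self-adjointness, also the
  orthogonal complement of \<open>W\<close> into itself. Hence
  \<open>S t (P x) + S t (x - P x)\<close> is the orthogonal decomposition of
  \<open>S t x\<close>.\<close>

lemma P_S_commute: assumes "t \<ge> 0" shows "P (S t x) = S t (P x)"
proof (rule orthogonal_projector_eqI[OF subspace_W projector])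
  show "S t (P x) \<in> W" using S_maps_W P_in assms by blast
  fix w assume "w \<in> W"
  have "subspace {w. S t (x - P x) \<bullet> w = 0}"
    by (auto simp: subspace_def inner_add_right)
  moreover have "B \<subseteq> {w. S t (x - P x) \<bullet> w = 0}"
  proof
    fix w assume w: "w \<in> B"
    then have "(x - P x) \<bullet> w = 0"
      using projector by (auto simp: orthogonal_projector_onto_def W_eq span_base)
    then show "w \<in> {w. S t (x - P x) \<bullet> w = 0}"
      using eigen[OF w] S_inner_eigenvector[OF self_adjoint _ _ assms] by (auto simp: eigenvector_of_def)
  qed
  ultimately have "span B \<subseteq> {w. S t (x - P x) \<bullet> w = 0}" by (intro span_minimal)
  then show "(S t x - S t (P x)) \<bullet> w = 0"
    using \<open>w \<in> W\<close> by (auto simp: W_eq blinfun.diff_right)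
qed

text \<open>In the variation-of-constants formula the Galerkin flow acts only on projected data, so
  this turns every term into the projection of a term of mild type.\<close>

lemma galerkin_exp_P: "t \<ge> 0 \<Longrightarrow> operator_exp (galerkin_operator P L) t (P x) = P (S t x)"
  by (simp add: galerkin_exp_eq P_in P_S_commute)

end

section \<open>Gronwall and Cauchy-Schwarz inequalities on an interval\<close>

text \<open>The right-hand side of the hypothesis, weighted by \<open>exp (- (c * (s - a)))\<close>,
  has a nonpositive derivative, so it is at most its initial value \<open>A\<close>.\<close>

lemma gronwall_integral:
  fixes \<phi> :: "real \<Rightarrow> real"
  assumes "a \<le> b" and cont: "continuous_on {a..b} \<phi>" and "c \<ge> 0"
    and le: "\<And>s. s \<in> {a..b} \<Longrightarrow> \<phi> s \<le> A + c * integral {a..s} \<phi>"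
  shows "\<phi> b \<le> A * exp (c * (b - a))"
proof (cases "a = b")
  case True
  then show ?thesis using le[of b] by simp
next
  case False
  let ?g = "\<lambda>s. exp (- (c * (s - a))) * (A + c * integral {a..s} \<phi>)"
  have deriv: "(?g has_real_derivative exp (- (c * (s - a))) * (c * (\<phi> s - (A + c * integral {a..s} \<phi>))))
      (at s within {a..b})" if "s \<in> {a..b}" for s
    using that
    by (auto intro!: derivative_eq_intros integral_has_real_derivative[OF cont] simp: algebra_simps)
  have "?g b \<le> ?g a"
  proof (rule DERIV_nonpos_imp_decreasing_open[of a b ?g])
    show "a \<le> b" by fact
    show "continuous_on {a..b} ?g"
      unfolding continuous_on_eq_continuous_within by (intro ballI DERIV_continuous[OF deriv])
    fix s assume s: "a < s" "s < b"
    have "exp (- (c * (s - a))) * (c * (\<phi> s - (A + c * integral {a..s} \<phi>))) \<le> 0"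
      using le[of s] s \<open>c \<ge> 0\<close> by (intro mult_nonneg_nonpos) auto
    then show "\<exists>y. (?g has_real_derivative y) (at s) \<and> y \<le> 0"
      using deriv[of s] s by (auto simp: at_within_Icc_at)
  qed
  then have "exp (c * (b - a)) * ?g b \<le> exp (c * (b - a)) * A"
    by (intro mult_left_mono) auto
  also have "exp (c * (b - a)) * ?g b = A + c * integral {a..b} \<phi>"
    by (simp flip: mult.assoc exp_add)
  finally show ?thesis using le[of b] \<open>a \<le> b\<close> by (simp add: mult.commute)
qed

text \<open>Cauchy-Schwarz against the constant 1, read off from the nonnegative integral of
  \<open>(norm (f s) - m)\<^sup>2\<close>, where \<open>m\<close> is the mean of
  \<open>norm (f s)\<close>.\<close>

lemma integral_le_L2_norm_on:
  fixes f :: "real \<Rightarrow> 'a::real_normed_vector"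
  assumes "a < b" and cont: "continuous_on {a..b} f"
  shows "integral {a..b} (\<lambda>s. norm (f s)) \<le> sqrt (b - a) * L2_norm_on a b f"
proof -
  define I Q m where "I = integral {a..b} (\<lambda>s. norm (f s))"
    and "Q = integral {a..b} (\<lambda>s. (norm (f s))\<^sup>2)" and "m = I / (b - a)"
  have cont': "continuous_on {a..b} (\<lambda>s. norm (f s))" "continuous_on {a..b} (\<lambda>s. (norm (f s))\<^sup>2)"
    by (intro continuous_intros cont)+
  note int = cont'[THEN integrable_continuous_real]
  have "0 \<le> integral {a..b} (\<lambda>s. (norm (f s) - m)\<^sup>2)"
    by (intro integral_nonneg integrable_continuous_real continuous_intros cont) auto
  also have "\<dots> = integral {a..b} (\<lambda>s. (norm (f s))\<^sup>2 - (2 * m) * norm (f s) + m\<^sup>2)"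
    by (simp add: power2_diff algebra_simps)
  also have "\<dots> = Q - 2 * m * I + m\<^sup>2 * (b - a)"
    using int \<open>a < b\<close>
    by (subst integral_add integral_diff;
        (intro integrable_diff integrable_on_mult_right integrable_const_ivl)?)
      (simp_all add: Q_def I_def integral_diff integrable_on_mult_right)
  finally have "I\<^sup>2 \<le> (b - a) * Q"
  proof -
    assume "0 \<le> Q - 2 * m * I + m\<^sup>2 * (b - a)"
    moreover have I: "I = (b - a) * m" using \<open>a < b\<close> by (simp add: m_def)
    then have "m\<^sup>2 * (b - a) = m * I" by (simp add: power2_eq_square)
    ultimately have "(b - a) * (m * I) \<le> (b - a) * Q"
      using \<open>a < b\<close> by (intro mult_left_mono) (simp_all add: mult.commute)
    then show ?thesis using I by (metis mult.assoc power2_eq_square)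
  qed
  then have "I \<le> sqrt ((b - a) * Q)" by (rule real_le_rsqrt)
  moreover have "(LINT s:{a..b}|lebesgue. (norm (f s))\<^sup>2) = Q"
    unfolding Q_def
    by (intro set_lebesgue_integral_eq_integral absolutely_integrable_continuous_real cont')
  ultimately show ?thesis by (simp add: L2_norm_on_def I_def real_sqrt_mult)
qed

lemma set_integrable_bounded_linear:
  fixes f :: "'a \<Rightarrow> 'b::{banach, second_countable_topology}"
    and P :: "'b \<Rightarrow> 'c::{banach, second_countable_topology}"
  assumes "bounded_linear P" "set_integrable M A f"
  shows "set_integrable M A (\<lambda>s. P (f s))" "(LINT s:A|M. P (f s)) = P (LINT s:A|M. f s)"
  using integrable_bounded_linear[OF assms(1), of M "\<lambda>s. indicator A s *\<^sub>R f s"]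
    integral_bounded_linear[OF assms(1), of M "\<lambda>s. indicator A s *\<^sub>R f s"] assms(2)
    linear_scale[OF bounded_linear.linear[OF assms(1)]]
  by (simp_all add: set_integrable_def set_lebesgue_integral_def)

section \<open>Distance between the Galerkin solution and the projected mild solution\<close>

context spectral_galerkin
begin

text \<open>The difference \<open>z - y\<close> splits into \<open>z - P y\<close>, on which
  Gronwall acts, and \<open>P y - y\<close>, whose integral is the source term. A Lipschitz constant
  on \<open>X\<close> suffices because both trajectories stay there. The factor \<open>k\<close>
  combines it with the bound for \<open>S\<close> on \<open>{0..b - a}\<close>.\<close>

lemma galerkin_error:
  assumes y: "mild_solution S F C a b x u y" and z: "galerkin_solution P L F C a b (P x) u z"
    and in_ball: "\<And>s. s \<in> {a..b} \<Longrightarrow> y s \<in> X \<and> z s \<in> X"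
    and lip: "l-lipschitz_on X F"
    and k_def: "k = M * exp (\<omega> * (b - a)) * l"
    and \<tau>: "\<tau> \<in> {a..b}"
  shows "norm (z \<tau> - P (y \<tau>))
    \<le> k * exp (k * (b - a)) * integral {a..b} (\<lambda>s. norm (y s - P (y s)))"
proof -
  interpret P: bounded_linear P by (rule bounded_linear_P)
  define \<phi> \<psi> where "\<phi> = (\<lambda>s. norm (z s - P (y s)))" and "\<psi> = (\<lambda>s. norm (y s - P (y s)))"
  note mild = y[unfolded mild_solution_def voc_solution_def]
    and gal = z[unfolded galerkin_solution_def voc_solution_def o_def]
  have cont: "continuous_on {a..b} y" "continuous_on {a..b} z" using mild gal by blast+
  have cont_\<phi>: "continuous_on {a..b} \<phi>" and cont_\<psi>: "continuous_on {a..b} \<psi>"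
    unfolding \<phi>_def \<psi>_def by (intro continuous_intros P.continuous_on cont)+
  have "l \<ge> 0" using lip by (rule lipschitz_on_nonneg)
  have "k \<ge> 0" using \<open>l \<ge> 0\<close> M_ge by (simp add: k_def)
  have bound: "\<phi> r \<le> k * integral {a..b} \<psi> + k * integral {a..r} \<phi>" if r: "r \<in> {a..b}" for r
  proof -
    let ?fy = "\<lambda>s. P (S (r - s) (F (y s)))" and ?fz = "\<lambda>s. P (S (r - s) (F (z s)))"
    let ?g = "\<lambda>s. P (S (r - s) (C (u s)))"
    let ?A = "galerkin_operator P L"
    have cont_r: "continuous_on {a..r} \<phi>" "continuous_on {a..r} \<psi>"
      using r by (auto intro: continuous_on_subset[OF cont_\<phi>] continuous_on_subset[OF cont_\<psi>])
    have mild_r: "set_integrable lebesgue {a..r} (\<lambda>s. S (r - s) (F (y s)))"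
      "set_integrable lebesgue {a..r} (\<lambda>s. S (r - s) (C (u s)))"
      "y r = S (r - a) x + (LINT s:{a..r}|lebesgue. S (r - s) (F (y s)))
        + (LINT s:{a..r}|lebesgue. S (r - s) (C (u s)))"
      using mild r by blast+
    \<comment> \<open>The projector may enter the integrals because their existence is part of being
      a mild solution.\<close>
    note project = mild_r(1,2)[THEN set_integrable_bounded_linear(2)[OF bounded_linear_P]]
    have fy: "set_integrable lebesgue {a..r} ?fy"
      using set_integrable_bounded_linear(1)[OF bounded_linear_P mild_r(1)] .
    have Py: "P (y r) = P (S (r - a) x) + (LINT s:{a..r}|lebesgue. ?fy s) + (LINT s:{a..r}|lebesgue. ?g s)"
      unfolding project mild_r(3) P.add ..
    have exp_eq: "operator_exp ?A (r - s) (P w) = P (S (r - s) w)" if "s \<in> {a..r}" for s w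
      using that by (intro galerkin_exp_P) simp
    have gal_r: "set_integrable lebesgue {a..r} (\<lambda>s. operator_exp ?A (r - s) (P (F (z s))))"
      "z r = operator_exp ?A (r - a) (P x)
        + (LINT s:{a..r}|lebesgue. operator_exp ?A (r - s) (P (F (z s))))
        + (LINT s:{a..r}|lebesgue. operator_exp ?A (r - s) (P (C (u s))))"
      using gal r by blast+
    have fz: "set_integrable lebesgue {a..r} ?fz"
      using gal_r(1) by (rule set_integrable_cong[THEN iffD1, rotated -1]) (simp_all add: exp_eq)
    have Pz: "z r = P (S (r - a) x) + (LINT s:{a..r}|lebesgue. ?fz s) + (LINT s:{a..r}|lebesgue. ?g s)"
    proof -
      have "(LINT s:{a..r}|lebesgue. operator_exp ?A (r - s) (P (h s)))
          = (LINT s:{a..r}|lebesgue. P (S (r - s) (h s)))" for h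
        by (intro set_lebesgue_integral_cong) (auto simp: exp_eq)
      then show ?thesis using gal_r(2) exp_eq[of a x] r by simp
    qed
    \<comment> \<open>The initial terms and the control integrals in \<open>Py\<close> and
      \<open>Pz\<close> are identical and cancel.\<close>
    have "\<phi> r = norm (LINT s:{a..r}|lebesgue. ?fz s - ?fy s)"
      using fy fz by (simp add: \<phi>_def Py Pz set_integral_diff)
    also have "\<dots> \<le> (LINT s:{a..r}|lebesgue. norm (?fz s - ?fy s))"
      using fy fz by (intro set_integral_norm_bound set_integral_diff)
    also have "\<dots> \<le> (LINT s:{a..r}|lebesgue. k * (\<phi> s + \<psi> s))"
    proof (rule set_integral_mono)
      show "set_integrable lebesgue {a..r} (\<lambda>s. norm (?fz s - ?fy s))"
        using fy fz by (intro set_integrable_norm set_integral_diff)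
      show "set_integrable lebesgue {a..r} (\<lambda>s. k * (\<phi> s + \<psi> s))"
        using cont_r by (intro absolutely_integrable_continuous_real continuous_intros)
      fix s assume s: "s \<in> {a..r}"
      then have "norm (?fz s - ?fy s) \<le> norm (S (r - s) (F (z s) - F (y s)))"
        using norm_orthogonal_projector_le[OF projector] by (simp add: P.diff blinfun.diff_right flip: P.diff)
      also have "\<dots> \<le> M * exp (\<omega> * (b - a)) * norm (F (z s) - F (y s))"
        using s r by (intro norm_S_le) auto
      also have "norm (F (z s) - F (y s)) \<le> l * norm (z s - y s)"
        using lipschitz_onD[OF lip] in_ball[of s] s r by (auto simp: dist_norm)
      also have "norm (z s - y s) \<le> \<phi> s + \<psi> s"
        using norm_triangle_ineq[of "z s - P (y s)" "P (y s) - y s"]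
        by (simp add: \<phi>_def \<psi>_def norm_minus_commute)
      finally show "norm (?fz s - ?fy s) \<le> k * (\<phi> s + \<psi> s)"
        using \<open>l \<ge> 0\<close> M_ge by (simp add: k_def mult.assoc mult_left_mono)
    qed
    also have "\<dots> = integral {a..r} (\<lambda>s. k * (\<phi> s + \<psi> s))"
      using cont_r by (intro set_lebesgue_integral_eq_integral absolutely_integrable_continuous_real continuous_intros)
    also have "\<dots> = k * integral {a..r} \<psi> + k * integral {a..r} \<phi>"
      using cont_r[THEN integrable_continuous_real]
      by (simp add: integral_add integrable_on_mult_right distrib_left)
    also have "integral {a..r} \<psi> \<le> integral {a..b} \<psi>"
      using r cont_r cont_\<psi> by (intro integral_subset_le integrable_continuous_real) (auto simp: \<psi>_def)
    finally show ?thesis using \<open>k \<ge> 0\<close> by (simp add: mult_left_mono)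
  qed
  \<comment> \<open>Gronwall on \<open>{a..\<tau>}\<close>; the constant \<open>A\<close> is
    \<open>k\<close> times the integral of \<open>\<psi>\<close> over all of \<open>{a..b}\<close>,
    hence independent of the running time.\<close>
  have "\<phi> \<tau> \<le> k * integral {a..b} \<psi> * exp (k * (\<tau> - a))"
    using \<tau> bound \<open>k \<ge> 0\<close> by (intro gronwall_integral continuous_on_subset[OF cont_\<phi>]) auto
  also have "\<dots> \<le> k * integral {a..b} \<psi> * exp (k * (b - a))"
    using \<tau> \<open>k \<ge> 0\<close> cont_\<psi>
    by (intro mult_left_mono mult_nonneg_nonneg integral_nonneg integrable_continuous_real)
      (auto simp: \<psi>_def mult_left_mono)
  finally show ?thesis by (simp add: \<phi>_def \<psi>_def mult_ac)
qed

end

section \<open>Comparison of costs and infima in the extended nonnegative reals\<close>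

text \<open>Costs may be infinite, so the comparison is stated additively and in one direction. The
  control cost is common to both sides, and the Lipschitz bound on \<open>G\<close> is integrated.
  Measurability of the control cost allows the integral of the sum to be split.\<close>

lemma running_cost_le:
  assumes cont: "continuous_on {t..T} y" "continuous_on {t..T} z"
    and in_X: "\<And>s. s \<in> {t..T} \<Longrightarrow> y s \<in> X \<and> z s \<in> X" and lip: "l-lipschitz_on X G"
    and E: "(\<lambda>s. E (u s)) \<in> borel_measurable (lebesgue_on {t..T})"
    and nonneg: "\<And>x. G x \<ge> 0" "\<And>w. E w \<ge> 0"
  shows "running_cost G E t T y u
    \<le> running_cost G E t T z u + ennreal (l * integral {t..T} (\<lambda>s. norm (y s - z s)))"
proof -
  let ?\<mu> = "lebesgue_on {t..T}"
  have cost: "running_cost G E t T h u = (\<integral>\<^sup>+ s. ennreal (G (h s) + E (u s)) \<partial>?\<mu>)" for h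
    by (simp add: running_cost_def nn_integral_restrict_space)
  have l: "l \<ge> 0" using lip by (rule lipschitz_on_nonneg)
  have "continuous_on {t..T} (\<lambda>s. G (z s))"
    using in_X by (intro continuous_on_compose2[OF lipschitz_on_continuous_on[OF lip] cont(2)]) auto
  then have Gz: "(\<lambda>s. G (z s)) \<in> borel_measurable ?\<mu>"
    by (intro continuous_imp_measurable_on_sets_lebesgue) auto
  have diff: "integrable ?\<mu> (\<lambda>s. l * norm (y s - z s))"
    by (intro continuous_imp_integrable_real continuous_intros cont)
  have "running_cost G E t T y u
      \<le> (\<integral>\<^sup>+ s. ennreal (G (z s) + E (u s)) + ennreal (l * norm (y s - z s)) \<partial>?\<mu>)"
    unfolding cost
  proof (rule nn_integral_mono)
    fix s assume "s \<in> space ?\<mu>"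
    then have "G (y s) \<le> G (z s) + l * norm (y s - z s)"
      using lipschitz_onD[OF lip, of "y s" "z s"] in_X[of s] by (auto simp: dist_norm)
    then show "ennreal (G (y s) + E (u s)) \<le> ennreal (G (z s) + E (u s)) + ennreal (l * norm (y s - z s))"
      using nonneg l by (simp flip: ennreal_plus)
  qed
  also have "\<dots> = running_cost G E t T z u + (\<integral>\<^sup>+ s. ennreal (l * norm (y s - z s)) \<partial>?\<mu>)"
    unfolding cost using Gz E borel_measurable_integrable[OF diff]
    by (intro nn_integral_add measurable_compose[OF _ measurable_ennreal] borel_measurable_add)
  also have "(\<integral>\<^sup>+ s. ennreal (l * norm (y s - z s)) \<partial>?\<mu>) = ennreal (\<integral>s. l * norm (y s - z s) \<partial>?\<mu>)"
    using l by (intro nn_integral_eq_integral diff) auto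
  also have "(\<integral>s. l * norm (y s - z s) \<partial>?\<mu>) = l * integral {t..T} (\<lambda>s. norm (y s - z s))"
    using lebesgue_integral_eq_integral[OF diff] by simp
  finally show ?thesis .
qed

text \<open>If one value is infinite, the hypotheses force the other to be infinite as well, and the
  convention for equal arguments applies; otherwise the smaller value is finite and can be
  subtracted.\<close>

lemma ennreal_absdiff_leI:
  assumes "a \<le> b + ennreal r" "b \<le> a + ennreal r"
  shows "ennreal_absdiff a b \<le> ennreal r"
  using assms by (auto simp: ennreal_absdiff_def max_def min_def ennreal_minus_le_iff)

lemma ennreal_absdiff_leD:
  assumes "ennreal_absdiff a b \<le> ennreal r"
  shows "a \<le> b + ennreal r" "b \<le> a + ennreal r"
  using assms
  by (auto simp: ennreal_absdiff_def max_def min_def ennreal_minus_le_iff add_increasing2 split: if_splits)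

text \<open>Both infima are attained, and \<open>J u \<le> J u' \<le> J' u' + r'\<close> while
  \<open>J' u' \<le> J' u \<le> J u + r\<close>. Each direction uses one of the two errors, and the
  sum dominates both.\<close>

lemma ennreal_absdiff_INF_le:
  assumes minimizers: "minimizer_over A J u" "minimizer_over A J' u'"
    and "ennreal_absdiff (J u) (J' u) \<le> ennreal r" "ennreal_absdiff (J u') (J' u') \<le> ennreal r'"
    and "0 \<le> r" "0 \<le> r'"
  shows "ennreal_absdiff (INF w\<in>A. J w) (INF w\<in>A. J' w) \<le> ennreal (r + r')"
proof -
  have eq: "(INF w\<in>A. J w) = J u" "(INF w\<in>A. J' w) = J' u'"
    using minimizers by (auto simp: minimizer_over_def intro!: antisym INF_lower INF_greatest)
  have "J u \<le> J u'" "J' u' \<le> J' u" using minimizers by (auto simp: minimizer_over_def)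
  moreover have "ennreal r \<le> ennreal (r + r')" "ennreal r' \<le> ennreal (r + r')"
    using assms(5,6) by (auto intro: ennreal_leI)
  ultimately show ?thesis
    unfolding eq using ennreal_absdiff_leD[OF assms(3)] ennreal_absdiff_leD[OF assms(4)]
    by (intro ennreal_absdiff_leI) (meson add_left_mono order_trans)+
qed

section \<open>Time translation and problems started at a later time\<close>

lemma distr_lebesgue_shift: "distr lebesgue lebesgue ((+) c) = (lebesgue :: real measure)"
  using lebesgue_real_affine[of 1 c] by (simp add: density_1)

lemma measurable_lebesgue_shift [measurable]: "(+) (c::real) \<in> lebesgue \<rightarrow>\<^sub>M lebesgue"
  using lebesgue_affine_measurable[of "\<lambda>_::real. 1" c] by simp

lemma set_integrable_lebesgue_shift:
  fixes f :: "real \<Rightarrow> 'a::{banach, second_countable_topology}"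
  assumes "set_integrable lebesgue {a..b} f"
  shows "set_integrable lebesgue {a - c..b - c} (\<lambda>s. f (c + s))"
    and "(LINT s:{a - c..b - c}|lebesgue. f (c + s)) = (LINT s:{a..b}|lebesgue. f s)"
proof -
  let ?g = "\<lambda>s. indicator {a..b} s *\<^sub>R f s"
  have ind: "indicator {a - c..b - c} s = (indicator {a..b} (c + s) :: real)" for s
    by (auto simp: indicator_def)
  have int: "integrable lebesgue ?g" using assms by (simp add: set_integrable_def)
  show "set_integrable lebesgue {a - c..b - c} (\<lambda>s. f (c + s))"
    using integrable_distr[OF measurable_lebesgue_shift, of c ?g] int
    by (simp add: set_integrable_def ind distr_lebesgue_shift)
  show "(LINT s:{a - c..b - c}|lebesgue. f (c + s)) = (LINT s:{a..b}|lebesgue. f s)"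
    using integral_distr[OF measurable_lebesgue_shift, of ?g c] int
    by (simp add: set_lebesgue_integral_def ind distr_lebesgue_shift)
qed

text \<open>The equation is autonomous: the kernel depends only on the time difference, and Lebesgue
  measure is translation invariant.\<close>

lemma voc_solution_shift:
  assumes "voc_solution S F B a b x u y"
  shows "voc_solution S F B (a - c) (b - c) x (\<lambda>s. u (c + s)) (\<lambda>s. y (c + s))"
  unfolding voc_solution_def
proof (intro conjI ballI)
  show "continuous_on {a - c..b - c} (\<lambda>s. y (c + s))"
    using assms
    by (auto simp: voc_solution_def intro!: continuous_on_compose2[of "{a..b}" y] continuous_intros)
  fix t assume t: "t \<in> {a - c..b - c}"
  have "c + t \<in> {a..b}" using t by auto
  then have *: "set_integrable lebesgue {a..c + t} (\<lambda>s. S (c + t - s) (F (y s)))"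
    "set_integrable lebesgue {a..c + t} (\<lambda>s. S (c + t - s) (B (u s)))"
    "y (c + t) = S (c + t - a) x + (LINT s:{a..c + t}|lebesgue. S (c + t - s) (F (y s)))
      + (LINT s:{a..c + t}|lebesgue. S (c + t - s) (B (u s)))"
    using assms unfolding voc_solution_def by blast+
  show "set_integrable lebesgue {a - c..t} (\<lambda>s. S (t - s) (F (y (c + s))))"
    "set_integrable lebesgue {a - c..t} (\<lambda>s. S (t - s) (B (u (c + s))))"
    using *(1,2)[THEN set_integrable_lebesgue_shift(1), of c] by simp_all
  show "y (c + t) = S (t - (a - c)) x + (LINT s:{a - c..t}|lebesgue. S (t - s) (F (y (c + s))))
      + (LINT s:{a - c..t}|lebesgue. S (t - s) (B (u (c + s))))"
    using *(3) *(1,2)[THEN set_integrable_lebesgue_shift(2), of c] by (simp add: algebra_simps)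
qed

text \<open>Needed because controls on \<open>{t..T}\<close> are restrictions, with an unspecified
  value elsewhere, and agree with shifted controls only on that interval.\<close>

lemma voc_solution_cong_control:
  assumes "voc_solution S F B a b x u y" "\<And>s. s \<in> {a..b} \<Longrightarrow> u s = u' s"
  shows "voc_solution S F B a b x u' y"
proof -
  have "set_integrable lebesgue {a..t} (\<lambda>s. S (t - s) (B (u s)))
      = set_integrable lebesgue {a..t} (\<lambda>s. S (t - s) (B (u' s)))"
    "(LINT s:{a..t}|lebesgue. S (t - s) (B (u s))) = (LINT s:{a..t}|lebesgue. S (t - s) (B (u' s)))"
    if "t \<in> {a..b}" for t
    using that assms(2) by (intro set_integrable_cong set_lebesgue_integral_cong; simp)+
  then show ?thesis using assms(1) unfolding voc_solution_def by simp
qed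

lemma voc_solution_mono:
  "voc_solution S F B a b x u y \<Longrightarrow> b' \<le> b \<Longrightarrow> voc_solution S F B a b' x u y"
  unfolding voc_solution_def by (auto intro: continuous_on_subset)

text \<open>Boundedness of \<open>U\<close> makes q-integrability automatic on intervals of finite
  length, so one function on the whole line serves as a control for every final time.\<close>

lemma admissible_controls_boundedI:
  assumes "bounded U" "q \<ge> 0" and f: "f \<in> borel_measurable lebesgue" and AE: "AE s in lebesgue. f s \<in> U"
  shows "f \<in> admissible_controls q U \<tau>"
proof -
  obtain r where r: "\<And>w. w \<in> U \<Longrightarrow> norm w \<le> r" using \<open>bounded U\<close> by (auto simp: bounded_iff)
  let ?\<mu> = "lebesgue_on {0..\<tau>}"
  interpret finite_measure ?\<mu> by (rule finite_measure_lebesgue_on) simp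
  have f': "f \<in> borel_measurable ?\<mu>" using f by (rule measurable_restrict_space1)
  have AE': "AE s in ?\<mu>. f s \<in> U" using AE by (simp add: AE_restrict_space_iff) (auto elim: eventually_mono)
  have "AE s in ?\<mu>. norm (norm (f s) powr q) \<le> r powr q"
    using AE' by eventually_elim (use r \<open>q \<ge> 0\<close> in \<open>auto intro: powr_mono2\<close>)
  then have "integrable ?\<mu> (\<lambda>s. norm (f s) powr q)" using f' by (intro integrable_const_bound) auto
  then show ?thesis using f' AE' by (simp add: admissible_controls_def)
qed

text \<open>
  A control on \<open>{t..T}\<close> is moved to \<open>{0..T - t}\<close> and extended by a constant of \<open>U\<close>, so that the a priori
  bound for the full horizon \<open>T\<close>, rather than for \<open>T - t\<close>, applies.
\<close>
lemma delayed_control_extension: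
  assumes u: "u \<in> admissible_controls_from q U t T" and "0 \<le> t" "t < T" "q \<ge> 0" "bounded U"
  obtains w where "\<And>\<tau>. w \<in> admissible_controls q U \<tau>" "\<And>s. s \<in> {t..T} \<Longrightarrow> w (s - t) = u s"
proof -
  obtain f where f: "f \<in> admissible_controls q U T" and u_eq: "u = restrict f {t..T}"
    using u by (auto simp: admissible_controls_from_def)
  have f_AE: "AE s in lebesgue_on {0..T}. f s \<in> U" using f by (simp add: admissible_controls_def)
  \<comment> \<open>The interval \<open>{0..T}\<close> has positive measure, so a property holding
    almost everywhere on it holds somewhere.\<close>
  have "U \<noteq> {}"
  proof
    assume "U = {}"
    then have "emeasure (lebesgue_on {0..T}) (space (lebesgue_on {0..T})) = 0"
      using f_AE ae_filter_eq_bot_iff[of "lebesgue_on {0..T}"] by (simp add: eventually_False)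
    then show False using assms(2,3) by (simp add: emeasure_restrict_space)
  qed
  then obtain u0 where u0: "u0 \<in> U" by blast
  define g where "g = (\<lambda>s. if s \<in> {0..T} then f s else u0)"
  have g: "g \<in> borel_measurable lebesgue"
    using f unfolding g_def admissible_controls_def by (simp add: measurable_restrict_space_iff[of _ _ u0])
  have "AE s in lebesgue. g s \<in> U"
    using f_AE u0 by (simp add: AE_restrict_space_iff g_def)
  then have "AE s in distr lebesgue lebesgue ((+) t). g s \<in> U" unfolding distr_lebesgue_shift .
  then have "AE s in lebesgue. g (t + s) \<in> U" by (rule AE_distrD[OF measurable_lebesgue_shift])
  then have "(\<lambda>s. g (t + s)) \<in> admissible_controls q U \<tau>" for \<tau>
    using g assms(4,5) by (intro admissible_controls_boundedI measurable_compose[OF measurable_lebesgue_shift]) auto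
  moreover have "g (t + (s - t)) = u s" if "s \<in> {t..T}" for s
    using that \<open>0 \<le> t\<close> by (simp add: u_eq g_def)
  ultimately show ?thesis using that by blast
qed

text \<open>Solvability and the a priori bound are assumed only for problems started at time 0.
  Shifting by \<open>t\<close> reduces the delayed problem to such a problem on
  \<open>{0..T - t}\<close>. The flow \<open>S\<close> is arbitrary here, so that the state equation
  and its Galerkin approximations are treated at once.\<close>

lemma delayed_solution:
  assumes u: "u \<in> admissible_controls_from q U t T" and "0 \<le> t" "t < T" "q \<ge> 0" "bounded U"
    and solvable: "\<And>\<tau> w. \<tau> > 0 \<Longrightarrow> w \<in> admissible_controls q U \<tau> \<Longrightarrow>
      uniquely_solvable_on 0 \<tau> (voc_solution S F B 0 \<tau> x w)"
    and bound: "\<And>w s. w \<in> admissible_controls q U T \<Longrightarrow> s \<in> {0..T} \<Longrightarrow>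
      norm ((SOME y. voc_solution S F B 0 T x w y) s) \<le> K"
  defines "y \<equiv> SOME y. voc_solution S F B t T x u y"
  shows "voc_solution S F B t T x u y" and "\<And>s. s \<in> {t..T} \<Longrightarrow> norm (y s) \<le> K"
proof -
  obtain w where w: "\<And>\<tau>. w \<in> admissible_controls q U \<tau>" and w_eq: "\<And>s. s \<in> {t..T} \<Longrightarrow> w (s - t) = u s"
    using delayed_control_extension[OF assms(1-5)] by blast
  let ?z = "SOME z. voc_solution S F B 0 T x w z"
  have "\<exists>z. voc_solution S F B 0 T x w z"
    using solvable[OF _ w, of T] assms(2,3) by (auto simp: uniquely_solvable_on_def)
  then have z: "voc_solution S F B 0 T x w ?z" by (rule someI_ex)
  \<comment> \<open>\<open>?z\<close> is the chosen solution over the full horizon \<open>T\<close>,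
    the one that the bound \<open>K\<close> speaks about; only its part up to \<open>T - t\<close>
    is used.\<close>
  then have z': "voc_solution S F B 0 (T - t) x w ?z" using \<open>0 \<le> t\<close> by (auto intro: voc_solution_mono)
  from voc_solution_shift[OF this, of "- t"]
  have "voc_solution S F B t T x u (\<lambda>s. ?z (- t + s))"
    using w_eq by (auto intro: voc_solution_cong_control)
  then have "\<exists>y. voc_solution S F B t T x u y" by blast
  then show y: "voc_solution S F B t T x u y" unfolding y_def by (rule someI_ex)
  fix s assume s: "s \<in> {t..T}"
  have "voc_solution S F B 0 (T - t) x w (\<lambda>s. y (t + s))"
    using voc_solution_shift[OF y, of t] w_eq[symmetric] by (auto intro: voc_solution_cong_control)
  \<comment> \<open>\<open>y\<close> is an arbitrary choice among solutions, so uniqueness for the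
    horizon \<open>T - t\<close> is what transfers the bound from \<open>?z\<close>.\<close>
  then have "y (t + (s - t)) = ?z (s - t)"
    using solvable[OF _ w, of "T - t"] z' \<open>t < T\<close> s unfolding uniquely_solvable_on_def
    by (metis atLeastAtMost_iff diff_ge_0_iff_ge diff_gt_0_iff_gt diff_right_mono)
  then show "norm (y s) \<le> K" using bound[OF w, of "s - t"] s \<open>0 \<le> t\<close> by auto
qed

section \<open>Error estimates for the cost functionals and the value functions\<close>

text \<open>Write \<open>y - z\<close> as \<open>(y - P y) - (z - P y)\<close>. The second part is
  bounded pointwise by \<open>c * I\<close>, so integration gives
  \<open>(1 + c * (b - a)) * I\<close>. Cauchy-Schwarz for \<open>I\<close> contributes the factor
  \<open>sqrt (b - a)\<close>, which accounts for both terms of the bracket.\<close>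

lemma (in spectral_galerkin) galerkin_cost_error:
  assumes y: "mild_solution S F C a b x u y" and z: "galerkin_solution P L F C a b (P x) u z"
    and "a < b" and in_ball: "\<And>s. s \<in> {a..b} \<Longrightarrow> y s \<in> X \<and> z s \<in> X"
    and lipF: "l-lipschitz_on X F" and k_def: "k = M * exp (\<omega> * (b - a)) * l"
    and lipG: "g-lipschitz_on X G"
    and E: "(\<lambda>s. E (u s)) \<in> borel_measurable (lebesgue_on {a..b})"
    and nonneg: "\<And>x. G x \<ge> 0" "\<And>w. E w \<ge> 0"
  shows "ennreal_absdiff (running_cost G E a b y u) (running_cost G E a b z u)
    \<le> ennreal (g * (sqrt (b - a) + k * exp (k * (b - a)) * sqrt (b - a) * (b - a))
        * L2_norm_on a b (\<lambda>s. y s - P (y s)))"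
proof -
  interpret P: bounded_linear P by (rule bounded_linear_P)
  define c I N where "c = k * exp (k * (b - a))"
    and "I = integral {a..b} (\<lambda>s. norm (y s - P (y s)))"
    and "N = L2_norm_on a b (\<lambda>s. y s - P (y s))"
  have cont: "continuous_on {a..b} y" "continuous_on {a..b} z"
    using y z by (auto simp: mild_solution_def galerkin_solution_def voc_solution_def)
  have cont_Py: "continuous_on {a..b} (\<lambda>s. P (y s))" by (intro P.continuous_on cont)
  have "g \<ge> 0" "l \<ge> 0" using lipF lipG by (auto intro: lipschitz_on_nonneg)
  then have "c \<ge> 0" using M_ge by (simp add: c_def k_def)
  have "integral {a..b} (\<lambda>s. norm (y s - z s))
      \<le> integral {a..b} (\<lambda>s. norm (y s - P (y s)) + c * I)"
  proof (rule integral_le)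
    show "(\<lambda>s. norm (y s - z s)) integrable_on {a..b}"
      "(\<lambda>s. norm (y s - P (y s)) + c * I) integrable_on {a..b}"
      by (intro integrable_continuous_real continuous_intros cont cont_Py)+
    fix s assume "s \<in> {a..b}"
    then have "norm (z s - P (y s)) \<le> c * I"
      unfolding c_def I_def using galerkin_error[OF y z in_ball lipF k_def] by blast
    then show "norm (y s - z s) \<le> norm (y s - P (y s)) + c * I"
      using norm_triangle_ineq4[of "y s - P (y s)" "z s - P (y s)"] by simp
  qed
  also have "\<dots> = I + integral {a..b} (\<lambda>s. c * I)"
    unfolding I_def
    by (intro integral_add integrable_continuous_real continuous_intros cont cont_Py)
  also have "\<dots> = (1 + c * (b - a)) * I" using \<open>a < b\<close> by (simp add: algebra_simps)
  also have "\<dots> \<le> (1 + c * (b - a)) * (sqrt (b - a) * N)"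
    unfolding I_def N_def using \<open>c \<ge> 0\<close> \<open>a < b\<close>
    by (intro mult_left_mono integral_le_L2_norm_on continuous_intros cont cont_Py) auto
  finally have "g * integral {a..b} (\<lambda>s. norm (y s - z s)) \<le> g * ((1 + c * (b - a)) * (sqrt (b - a) * N))"
    using \<open>g \<ge> 0\<close> by (rule mult_left_mono)
  also have "\<dots> = g * (sqrt (b - a) + c * sqrt (b - a) * (b - a)) * N" by (simp add: algebra_simps)
  finally have le: "ennreal (g * integral {a..b} (\<lambda>s. norm (y s - z s)))
      \<le> ennreal (g * (sqrt (b - a) + c * sqrt (b - a) * (b - a)) * N)"
    by (rule ennreal_leI)
  have swap: "integral {a..b} (\<lambda>s. norm (z s - y s)) = integral {a..b} (\<lambda>s. norm (y s - z s))"
    by (simp add: norm_minus_commute)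
  show ?thesis
    unfolding c_def[symmetric] N_def[symmetric]
    using running_cost_le[where u = u, OF cont in_ball lipG E nonneg]
      running_cost_le[where u = u, OF cont(2,1) _ lipG E nonneg] in_ball le unfolding swap
    by (intro ennreal_absdiff_leI) (meson add_left_mono order_trans)+
qed

lemma admissible_controls_from_measurable:
  assumes "u \<in> admissible_controls_from q U t T" "0 \<le> t"
  shows "u \<in> borel_measurable (lebesgue_on {t..T})"
proof -
  obtain f where f: "f \<in> borel_measurable (lebesgue_on {0..T})" "u = restrict f {t..T}"
    using assms(1) by (auto simp: admissible_controls_from_def admissible_controls_def)
  then have "f \<in> borel_measurable (lebesgue_on {t..T})"
    using assms(2) by (auto intro: measurable_restrict_mono)
  then show ?thesis unfolding f(2) by (subst measurable_cong[where g = f]) auto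
qed

theorem theorem2p3:
  fixes S :: "real \<Rightarrow> 'h::{real_inner, banach, second_countable_topology} \<Rightarrow>\<^sub>L 'h"
    and D :: "'h set" and L :: "'h \<Rightarrow> 'h" and F :: "'h \<Rightarrow> 'h"
    and C :: "'v::{real_inner, banach, second_countable_topology} \<Rightarrow> 'h"
    and M \<omega> q T :: real and U :: "'v set"
    and H :: "nat \<Rightarrow> 'h set" and P :: "nat \<Rightarrow> 'h \<Rightarrow> 'h" and e :: "nat \<Rightarrow> 'h"
    and S\<^sub>N :: "nat \<Rightarrow> real \<Rightarrow> 'h \<Rightarrow>\<^sub>L 'h"
    and K :: "real \<Rightarrow> 'h \<Rightarrow> real"
    and G :: "'h \<Rightarrow> real" and E :: "'v \<Rightarrow> real"
    and Y :: "real \<Rightarrow> real \<Rightarrow> 'h \<Rightarrow> (real \<Rightarrow> 'v) \<Rightarrow> real \<Rightarrow> 'h"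
    and Y\<^sub>N :: "nat \<Rightarrow> real \<Rightarrow> real \<Rightarrow> 'h \<Rightarrow> (real \<Rightarrow> 'v) \<Rightarrow> real \<Rightarrow> 'h"
    and Uad :: "real \<Rightarrow> (real \<Rightarrow> 'v) set"
    and J :: "real \<Rightarrow> 'h \<Rightarrow> (real \<Rightarrow> 'v) \<Rightarrow> ennreal"
    and J\<^sub>N :: "nat \<Rightarrow> real \<Rightarrow> 'h \<Rightarrow> (real \<Rightarrow> 'v) \<Rightarrow> ennreal"
    and v :: "real \<Rightarrow> 'h \<Rightarrow> ennreal"
    and v\<^sub>N :: "nat \<Rightarrow> real \<Rightarrow> 'h \<Rightarrow> ennreal"
  defines "Y \<equiv> \<lambda>a b. the_mild_solution S F C a b"
    and "Y\<^sub>N \<equiv> \<lambda>N a b. the_galerkin_solution (P N) L F C a b"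
    and "Uad \<equiv> \<lambda>t. admissible_controls_from q U t T"
    and "J \<equiv> \<lambda>t x u. running_cost G E t T (Y t T x u) u"
    and "J\<^sub>N \<equiv> \<lambda>N t x\<^sub>N u. running_cost G E t T (Y\<^sub>N N t T x\<^sub>N u) u"
    and "v \<equiv> \<lambda>t x. INF u\<in>Uad t. J t x u"
    and "v\<^sub>N \<equiv> \<lambda>N t x\<^sub>N. INF u\<in>Uad t. J\<^sub>N N t x\<^sub>N u"
  assumes "C 0 = 0"
    and "C0_semigroup S" and "infinitesimal_generator S D L"
    and "M \<ge> 1" and "\<omega> \<ge> 0" and "\<And>t. t \<ge> 0 \<Longrightarrow> norm (S t) \<le> M * exp (\<omega> * t)"
    and "\<And>N. N \<ge> 1 \<Longrightarrow> subspace (H N) \<and> (\<exists>B. finite B \<and> span B = H N) \<and> H N \<subseteq> D"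
    and "\<And>N. N \<ge> 1 \<Longrightarrow> orthogonal_projector_onto (H N) (P N)"
    and "\<And>x. (\<lambda>N. norm (P N x - x)) \<longlonglongrightarrow> 0"
    and "T > 0" and "q \<ge> 1" and "bounded U"
    and a1: "\<And>N. N \<ge> 1 \<Longrightarrow> C0_semigroup (S\<^sub>N N)
          \<and> (\<forall>t\<ge>0. \<forall>x\<in>H N. blinfun_apply (S\<^sub>N N t) x
               = operator_exp (galerkin_operator (P N) L) t x)
          \<and> (\<forall>t\<ge>0. norm (S\<^sub>N N t) \<le> M * exp (\<omega> * t))"
    and a2: "\<And>x. x \<in> D \<Longrightarrow> (\<lambda>N. norm (galerkin_operator (P N) L x - L x)) \<longlonglongrightarrow> 0"
    and a3: "lipschitz_on_balls F"
    and b1: "self_adjoint_operator D L"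
    and b2: "\<And>k. k \<ge> 1 \<Longrightarrow> eigenvector_of D L (e k)"
    and b3: "\<And>N. N \<ge> 1 \<Longrightarrow> H N = span (e ` {1..N})"
    and c1: "\<And>\<tau> x u. \<tau> > 0 \<Longrightarrow> u \<in> admissible_controls q U \<tau> \<Longrightarrow>
          uniquely_solvable_on 0 \<tau> (mild_solution S F C 0 \<tau> x u)
          \<and> (\<forall>N\<ge>1. uniquely_solvable_on 0 \<tau>
                (galerkin_solution (P N) L F C 0 \<tau> (P N x) u))"
    and c2: "\<And>\<tau> x u t. \<tau> > 0 \<Longrightarrow> u \<in> admissible_controls q U \<tau> \<Longrightarrow> t \<in> {0..\<tau>} \<Longrightarrow>
          norm (Y 0 \<tau> x u t) \<le> K \<tau> x
          \<and> (\<forall>N\<ge>1. norm (Y\<^sub>N N 0 \<tau> (P N x) u t) \<le> K \<tau> x)"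
    and d1: "\<And>x. G x \<ge> 0" and d2: "lipschitz_on_balls G"
    and d3: "\<And>w. E w \<ge> 0" and d4: "continuous_on UNIV E"
    and e1: "\<And>t x. t \<in> {0..<T} \<Longrightarrow>
          (\<exists>u. minimizer_over (Uad t) (J t x) u)
          \<and> (\<forall>N\<ge>1. \<exists>u. minimizer_over (Uad t) (J\<^sub>N N t (P N x)) u)"
  shows "\<forall>t\<in>{0..<T}. \<forall>x. \<exists>\<gamma>>0. \<forall>LipG>0. LipG-lipschitz_on (cball 0 (K T x)) G \<longrightarrow>
     (\<forall>N\<ge>1. \<forall>u\<in>Uad t.
        ennreal_absdiff (J t x u) (J\<^sub>N N t (P N x) u)
        \<le> ennreal (LipG * (sqrt (T - t) + \<gamma> * (T - t))
             * L2_norm_on t T (\<lambda>s. Y t T x u s - P N (Y t T x u s)))) \<and>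
     (\<forall>N\<ge>1. \<forall>u' u\<^sub>N.
        minimizer_over (Uad t) (J t x) u' \<longrightarrow>
        minimizer_over (Uad t) (J\<^sub>N N t (P N x)) u\<^sub>N \<longrightarrow>
        ennreal_absdiff (v t x) (v\<^sub>N N t (P N x))
        \<le> ennreal (LipG * (sqrt (T - t) + \<gamma> * (T - t))
             * (L2_norm_on t T (\<lambda>s. Y t T x u' s - P N (Y t T x u' s))
              + L2_norm_on t T (\<lambda>s. Y t T x u\<^sub>N s - P N (Y t T x u\<^sub>N s)))))"
proof (intro ballI allI)
  fix t x assume t: "t \<in> {0..<T}"
  then have t0: "0 \<le> t" "t < T" by auto
  \<comment> \<open>\<open>lipschitz_on_balls\<close> provides constants for positive radii only,
    and \<open>K T x\<close> is not assumed positive.\<close>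
  define R where "R = max (K T x) 1"
  obtain l where "l > 0" and lipF_R: "l-lipschitz_on (cball 0 R) F"
    using a3 by (auto simp: lipschitz_on_balls_def R_def dest!: spec[of _ "max (K T x) 1"])
  have lipF: "l-lipschitz_on (cball 0 (K T x)) F"
    using lipF_R by (rule lipschitz_on_subset) (auto simp: R_def)
  define k where "k = M * exp (\<omega> * (T - t)) * l"
  \<comment> \<open>The coefficient of \<open>T - t\<close> in the cost estimate. It is built from
    \<open>M\<close>, \<omega>, \<open>T - t\<close> and the Lipschitz constant of \<open>F\<close>,
    so it depends on neither \<open>N\<close> nor the control.\<close>
  define \<gamma> where "\<gamma> = k * exp (k * (T - t)) * sqrt (T - t)"
  have "k > 0" using \<open>M \<ge> 1\<close> \<open>l > 0\<close> by (simp add: k_def)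
  then have "\<gamma> > 0" using t0 by (simp add: \<gamma>_def)
  have cost: "ennreal_absdiff (J t x u) (J\<^sub>N N t (P N x) u)
      \<le> ennreal (g * (sqrt (T - t) + \<gamma> * (T - t)) * L2_norm_on t T (\<lambda>s. Y t T x u s - P N (Y t T x u s)))"
    if g: "g-lipschitz_on (cball 0 (K T x)) G" and N: "N \<ge> 1" and u: "u \<in> Uad t" for g N u
  proof -
    interpret spectral_galerkin S D L M \<omega> "e ` {1..N}" "H N" "P N"
      using assms(9-15) N b1 b2 b3 by unfold_locales auto
    have u': "u \<in> admissible_controls_from q U t T" using u by (simp add: Uad_def)
    have "q \<ge> 0" using \<open>q \<ge> 1\<close> by simp
    \<comment> \<open>Used once with the semigroup and once with the Galerkin flow; the bound
      \<open>K T x\<close> for the full horizon keeps both trajectories in the same ball.\<close>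
    note delayed = delayed_solution[OF u' t0 \<open>q \<ge> 0\<close> \<open>bounded U\<close>, where K = "K T x"]
    have mild: "mild_solution S F C t T x u (Y t T x u)"
      "\<And>s. s \<in> {t..T} \<Longrightarrow> norm (Y t T x u s) \<le> K T x"
      using c1 c2[OF \<open>T > 0\<close>] unfolding Y_def the_mild_solution_def mild_solution_def
      by (intro delayed; blast)+
    have galerkin: "galerkin_solution (P N) L F C t T (P N x) u (Y\<^sub>N N t T (P N x) u)"
      "\<And>s. s \<in> {t..T} \<Longrightarrow> norm (Y\<^sub>N N t T (P N x) u s) \<le> K T x"
      using N c1 c2[OF \<open>T > 0\<close>] unfolding Y\<^sub>N_def the_galerkin_solution_def galerkin_solution_def
      by (intro delayed; blast)+
    have "(\<lambda>s. E (u s)) \<in> borel_measurable (lebesgue_on {t..T})"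
      using admissible_controls_from_measurable[OF u' t0(1)] borel_measurable_continuous_onI[OF d4]
      by (rule measurable_compose)
    then show ?thesis
      unfolding J_def J\<^sub>N_def \<gamma>_def using mild(2) galerkin(2) d1 d3
      by (intro galerkin_cost_error[OF mild(1) galerkin(1) t0(2) _ lipF k_def g]) auto
  qed
  show "\<exists>\<gamma>>0. \<forall>LipG>0. LipG-lipschitz_on (cball 0 (K T x)) G \<longrightarrow>
     (\<forall>N\<ge>1. \<forall>u\<in>Uad t.
        ennreal_absdiff (J t x u) (J\<^sub>N N t (P N x) u)
        \<le> ennreal (LipG * (sqrt (T - t) + \<gamma> * (T - t))
             * L2_norm_on t T (\<lambda>s. Y t T x u s - P N (Y t T x u s)))) \<and>
     (\<forall>N\<ge>1. \<forall>u' u\<^sub>N.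
        minimizer_over (Uad t) (J t x) u' \<longrightarrow>
        minimizer_over (Uad t) (J\<^sub>N N t (P N x)) u\<^sub>N \<longrightarrow>
        ennreal_absdiff (v t x) (v\<^sub>N N t (P N x))
        \<le> ennreal (LipG * (sqrt (T - t) + \<gamma> * (T - t))
             * (L2_norm_on t T (\<lambda>s. Y t T x u' s - P N (Y t T x u' s))
              + L2_norm_on t T (\<lambda>s. Y t T x u\<^sub>N s - P N (Y t T x u\<^sub>N s)))))"
  proof (intro exI[of _ \<gamma>] conjI allI impI ballI \<open>\<gamma> > 0\<close>)
    fix g :: real and N :: nat and u
    assume "g-lipschitz_on (cball 0 (K T x)) G" "N \<ge> 1" "u \<in> Uad t"
    then show "ennreal_absdiff (J t x u) (J\<^sub>N N t (P N x) u)
        \<le> ennreal (g * (sqrt (T - t) + \<gamma> * (T - t))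
             * L2_norm_on t T (\<lambda>s. Y t T x u s - P N (Y t T x u s)))"
      by (rule cost)
  next
    fix g :: real and N :: nat and u' u\<^sub>N
    assume g: "g > 0" "g-lipschitz_on (cball 0 (K T x)) G" and N: "N \<ge> 1"
      and minimizers: "minimizer_over (Uad t) (J t x) u'" "minimizer_over (Uad t) (J\<^sub>N N t (P N x)) u\<^sub>N"
    have "u' \<in> Uad t" "u\<^sub>N \<in> Uad t" using minimizers by (auto simp: minimizer_over_def)
    note cost_bounds = this[THEN cost[OF g(2) N]]
    show "ennreal_absdiff (v t x) (v\<^sub>N N t (P N x))
        \<le> ennreal (g * (sqrt (T - t) + \<gamma> * (T - t))
             * (L2_norm_on t T (\<lambda>s. Y t T x u' s - P N (Y t T x u' s))
              + L2_norm_on t T (\<lambda>s. Y t T x u\<^sub>N s - P N (Y t T x u\<^sub>N s))))"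
      \<comment> \<open>Distributing the factor exhibits the bound as the sum of the cost errors at
        the two minimizers.\<close>
      unfolding v_def v\<^sub>N_def distrib_left[of "g * (sqrt (T - t) + \<gamma> * (T - t))"]
      using g \<open>\<gamma> > 0\<close> t0
      by (intro ennreal_absdiff_INF_le[OF minimizers, OF cost_bounds])
        (auto simp: L2_norm_on_def set_lebesgue_integral_def)
  qed
qed

end
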